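(* Let $G$ be a group and let $\sigma$ be a group automorphism of $G$. If the displacement group $\mathrm{Dis}(X)$ of the generalized Alexander quandle $X := \mathrm{GAlex}(G, \sigma)$ is finitely generated, then any connected component $O$ of the quandle $X$ with a displacement metric $d^{\mathrm{Dis}}_U$ ($U$ any finite generating set of $\mathrm{Dis}(X)$) is quasi-isometric to the displacement group $\mathrm{Dis}(X)$ with a word metric (with respect to any finite generating set).
   Context: A quandle is a non-empty set $X$ with a binary operation $\triangleleft$ such that (i) $x \triangleleft x = x$ for all $x$; (ii) for every $y \in X$ the map $s_y \colon X \to X$, $s_y(x) = x \triangleleft y$, is a bijection (the point symmetry at $y$); (iii) $(x \triangleleft y)\triangleleft z = (x \triangleleft z)\triangleleft (y \triangleleft z)$ for all $x,y,z$. $\mathrm{Aut}(X)$ is the group of bijective quandle homomorphisms $X\to X$ with product $fg := g \circ f$; it acts on $X$ from the right by $x\cdot f := f(x)$. $\mathrm{Inn}(X)$ is the subgroup of $\mathrm{Aut}(X)$ generated by $\{s_y \mid y \in X\}$, and the displacement group $\mathrm{Dis}(X)$ is the subgroup generated by $\{s_x s_y^{-1} \mid x,y\in X\}$. A connected component of $X$ is an orbit of $\mathrm{Inn}(X)$; the orbits of $\mathrm{Dis}(X)$ on $X$ are the same sets. For a group $G$ and an automorphism $\sigma$ of $G$, the generalized Alexander quandle $\mathrm{GAlex}(G,\sigma)$ is the set $G$ with the operation $x \triangleleft y := \sigma(xy^{-1})y$. For a generating set $U$ of $\mathrm{Dis}(X)$, consider the undirected graph with vertex set $X$ in which $x,y$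 are joined by an edge if $y = x\cdot u$ for some $u \in U\cup U^{-1}$. Its connected components are the connected components of $X$; the displacement metric $d^{\mathrm{Dis}}_U$ on a connected component is the path metric of this graph (edges have length one). *)

theory Defs
  imports Complex_Main "HOL-Algebra.Generated_Groups" "HOL-Algebra.Bij" "HOL-Algebra.Group_Action"
begin

section \<open>Quandles\<close>

record 'a quandle = "'a partial_object" +
  qop :: "'a \<Rightarrow> 'a \<Rightarrow> 'a" (infixl "\<triangleleft>\<index>" 70)

locale quandle =
  fixes X (structure)
  assumes nonempty: "carrier X \<noteq> {}"
    and idem: "x \<in> carrier X \<Longrightarrow> x \<triangleleft> x = x"
    and bij: "y \<in> carrier X \<Longrightarrow> bij_betw (\<lambda>x. x \<triangleleft> y) (carrier X) (carrier X)"
    and distrib: "\<lbrakk>x \<in> carrier X; y \<in> carrier X; z \<in> carrier X\<rbrakk> \<Longrightarrow>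
      (x \<triangleleft> y) \<triangleleft> z = (x \<triangleleft> z) \<triangleleft> (y \<triangleleft> z)"

text \<open>As for \<^const>\<open>Bij\<close>, maps are extensional, so that an automorphism is determined by its
  values on the carrier.\<close>

definition point_sym :: "('a, 'm) quandle_scheme \<Rightarrow> 'a \<Rightarrow> 'a \<Rightarrow> 'a" where
  "point_sym X y = (\<lambda>x \<in> carrier X. x \<triangleleft>\<^bsub>X\<^esub> y)"

text \<open>The product of \<open>f\<close> and \<open>g\<close> is \<open>g \<circ> f\<close> (opposite to \<^const>\<open>BijGroup\<close>), so that the group
  acts on \<open>X\<close> from the right by evaluation.\<close>

definition Aut :: "('a, 'm) quandle_scheme \<Rightarrow> ('a \<Rightarrow> 'a) monoid" where
  "Aut X = \<lparr>carrier = {f \<in> Bij (carrier X). \<forall>x \<in> carrier X. \<forall>y \<in> carrier X.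
                         f (x \<triangleleft>\<^bsub>X\<^esub> y) = f x \<triangleleft>\<^bsub>X\<^esub> f y},
            mult = (\<lambda>f g. compose (carrier X) g f),
            one = (\<lambda>x \<in> carrier X. x)\<rparr>"

definition Inn :: "('a, 'm) quandle_scheme \<Rightarrow> ('a \<Rightarrow> 'a) monoid" where
  "Inn X = (Aut X)\<lparr>carrier := generate (Aut X) {point_sym X y | y. y \<in> carrier X}\<rparr>"

definition Dis :: "('a, 'm) quandle_scheme \<Rightarrow> ('a \<Rightarrow> 'a) monoid" where
  "Dis X = (Aut X)\<lparr>carrier := generate (Aut X)
     {point_sym X x \<otimes>\<^bsub>Aut X\<^esub> inv\<^bsub>Aut X\<^esub> point_sym X y | x y. x \<in> carrier X \<and> y \<in> carrier X}\<rparr>"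

definition connected_components :: "('a, 'm) quandle_scheme \<Rightarrow> 'a set set" where
  "connected_components X = orbits (Inn X) (carrier X) (\<lambda>f x. f x)"

definition GAlex :: "('a, 'm) monoid_scheme \<Rightarrow> ('a \<Rightarrow> 'a) \<Rightarrow> 'a quandle" where
  "GAlex G \<sigma> = \<lparr>carrier = carrier G, qop = (\<lambda>x y. \<sigma> (x \<otimes>\<^bsub>G\<^esub> inv\<^bsub>G\<^esub> y) \<otimes>\<^bsub>G\<^esub> y)\<rparr>"

context quandle
begin

lemma closed: "\<lbrakk>x \<in> carrier X; y \<in> carrier X\<rbrakk> \<Longrightarrow> x \<triangleleft> y \<in> carrier X"
  using bij[of y] by (auto simp: bij_betw_def)

lemma point_sym_in_Aut: "y \<in> carrier X \<Longrightarrow> point_sym X y \<in> carrier (Aut X)"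
  using bij[of y] by (auto simp: Aut_def point_sym_def Bij_def closed intro: distrib cong: bij_betw_cong)

lemma group_Aut: "group (Aut X)"
proof (rule groupI)
  fix f g assume "f \<in> carrier (Aut X)" "g \<in> carrier (Aut X)"
  moreover then have "f x \<in> carrier X" if "x \<in> carrier X" for x
    using that by (auto simp: Aut_def dest: Bij_imp_funcset)
  ultimately show "f \<otimes>\<^bsub>Aut X\<^esub> g \<in> carrier (Aut X)"
    by (simp add: Aut_def compose_Bij compose_eq closed)
next
  show "\<one>\<^bsub>Aut X\<^esub> \<in> carrier (Aut X)"
    by (simp add: Aut_def id_Bij closed)
next
  fix f assume f: "f \<in> carrier (Aut X)"
  let ?g = "\<lambda>x \<in> carrier X. inv_into (carrier X) f x"
  have "?g \<in> carrier (Aut X)"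
    using f by (auto simp: Aut_def restrict_inv_into_Bij Bij_inv_into_mem closed intro!: Bij_inv_into_lemma)
  moreover have "?g \<otimes>\<^bsub>Aut X\<^esub> f = \<one>\<^bsub>Aut X\<^esub>"
    using f by (auto simp: Aut_def Bij_def bij_betw_def compose_def fun_eq_iff f_inv_into_f)
  ultimately show "\<exists>g \<in> carrier (Aut X). g \<otimes>\<^bsub>Aut X\<^esub> f = \<one>\<^bsub>Aut X\<^esub>"
    by blast
qed (auto simp: Aut_def compose_assoc Bij_imp_funcset Bij_imp_extensional
    intro: compose_Id[OF Bij_imp_funcset Bij_imp_extensional])

end

lemma quandle_GAlex:
  assumes "group G" and "\<sigma> \<in> iso G G"
  shows "quandle (GAlex G \<sigma>)"
proof -
  interpret group G by fact
  interpret hom: group_hom G G \<sigma>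
    using assms by (simp add: group_hom_def group_hom_axioms_def iso_def)
  have bij: "bij_betw \<sigma> (carrier G) (carrier G)"
    using assms(2) by (simp add: iso_def)
  show ?thesis
  proof
    show "carrier (GAlex G \<sigma>) \<noteq> {}"
      by (auto simp: GAlex_def)
  next
    fix x assume "x \<in> carrier (GAlex G \<sigma>)"
    then show "x \<triangleleft>\<^bsub>GAlex G \<sigma>\<^esub> x = x"
      by (simp add: GAlex_def)
  next
    fix y assume "y \<in> carrier (GAlex G \<sigma>)"
    then have y: "y \<in> carrier G" by (simp add: GAlex_def)
    have t: "bij_betw (\<lambda>x. x \<otimes>\<^bsub>G\<^esub> a) (carrier G) (carrier G)" if "a \<in> carrier G" for a
      by (rule bij_betw_byWitness[where f' = "\<lambda>x. x \<otimes>\<^bsub>G\<^esub> inv\<^bsub>G\<^esub> a"]) (use that in \<open>auto simp: m_assoc\<close>)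
    have "bij_betw ((\<lambda>x. x \<otimes>\<^bsub>G\<^esub> y) \<circ> (\<sigma> \<circ> (\<lambda>x. x \<otimes>\<^bsub>G\<^esub> inv\<^bsub>G\<^esub> y))) (carrier G) (carrier G)"
      by (rule bij_betw_trans[OF bij_betw_trans[OF t bij] t]) (use y in simp_all)
    then show "bij_betw (\<lambda>x. x \<triangleleft>\<^bsub>GAlex G \<sigma>\<^esub> y) (carrier (GAlex G \<sigma>)) (carrier (GAlex G \<sigma>))"
      by (simp add: GAlex_def comp_def)
  next
    fix x y z
    assume "x \<in> carrier (GAlex G \<sigma>)" "y \<in> carrier (GAlex G \<sigma>)" "z \<in> carrier (GAlex G \<sigma>)"
    then have [simp]: "x \<in> carrier G" "y \<in> carrier G" "z \<in> carrier G"
      by (simp_all add: GAlex_def)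
    have cancel: "inv\<^bsub>G\<^esub> a \<otimes>\<^bsub>G\<^esub> (a \<otimes>\<^bsub>G\<^esub> b) = b" "a \<otimes>\<^bsub>G\<^esub> (inv\<^bsub>G\<^esub> a \<otimes>\<^bsub>G\<^esub> b) = b"
      if "a \<in> carrier G" "b \<in> carrier G" for a b
      using that by (simp_all flip: m_assoc)
    have "(\<sigma> (x \<otimes>\<^bsub>G\<^esub> inv\<^bsub>G\<^esub> z) \<otimes>\<^bsub>G\<^esub> z) \<otimes>\<^bsub>G\<^esub> inv\<^bsub>G\<^esub> (\<sigma> (y \<otimes>\<^bsub>G\<^esub> inv\<^bsub>G\<^esub> z) \<otimes>\<^bsub>G\<^esub> z) = \<sigma> (x \<otimes>\<^bsub>G\<^esub> inv\<^bsub>G\<^esub> y)"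
      by (simp add: inv_mult_group m_assoc cancel)
    then show "(x \<triangleleft>\<^bsub>GAlex G \<sigma>\<^esub> y) \<triangleleft>\<^bsub>GAlex G \<sigma>\<^esub> z =
        (x \<triangleleft>\<^bsub>GAlex G \<sigma>\<^esub> z) \<triangleleft>\<^bsub>GAlex G \<sigma>\<^esub> (y \<triangleleft>\<^bsub>GAlex G \<sigma>\<^esub> z)"
      by (simp add: GAlex_def m_assoc)
  qed
qed

section \<open>Word metrics, displacement metrics and quasi-isometries\<close>

definition generates :: "('a, 'm) monoid_scheme \<Rightarrow> 'a set \<Rightarrow> bool" where
  "generates H S \<longleftrightarrow> S \<subseteq> carrier H \<and> generate H S = carrier H"

definition finitely_generated :: "('a, 'm) monoid_scheme \<Rightarrow> bool" where
  "finitely_generated H \<longleftrightarrow> (\<exists>S. finite S \<and> generates H S)"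

definition sym_gens :: "('a, 'm) monoid_scheme \<Rightarrow> 'a set \<Rightarrow> 'a set" where
  "sym_gens H S = S \<union> m_inv H ` S"

definition word_length :: "('a, 'm) monoid_scheme \<Rightarrow> 'a set \<Rightarrow> 'a \<Rightarrow> nat" where
  "word_length H S g = (LEAST n. \<exists>ws. length ws = n \<and> set ws \<subseteq> sym_gens H S \<and>
     foldr (mult H) ws \<one>\<^bsub>H\<^esub> = g)"

definition word_metric :: "('a, 'm) monoid_scheme \<Rightarrow> 'a set \<Rightarrow> 'a \<Rightarrow> 'a \<Rightarrow> real" where
  "word_metric H S g h = real (word_length H S (inv\<^bsub>H\<^esub> g \<otimes>\<^bsub>H\<^esub> h))"

text \<open>Edges are unordered pairs represented by a symmetric relation on the vertices. The path metric
  is meaningful only for vertices in the same connected component of the graph.\<close>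

definition path_metric :: "('a \<times> 'a) set \<Rightarrow> 'a \<Rightarrow> 'a \<Rightarrow> real" where
  "path_metric E x y = real (LEAST n. (x, y) \<in> E ^^ n)"

definition dis_graph :: "('a, 'm) quandle_scheme \<Rightarrow> ('a \<Rightarrow> 'a) set \<Rightarrow> ('a \<times> 'a) set" where
  "dis_graph X U = {(x, y). x \<in> carrier X \<and> y \<in> carrier X \<and> (\<exists>u \<in> sym_gens (Dis X) U. y = u x)}"

definition dis_metric :: "('a, 'm) quandle_scheme \<Rightarrow> ('a \<Rightarrow> 'a) set \<Rightarrow> 'a \<Rightarrow> 'a \<Rightarrow> real" where
  "dis_metric X U = path_metric (dis_graph X U)"

definition quasi_isometric :: "'a set \<Rightarrow> ('a \<Rightarrow> 'a \<Rightarrow> real) \<Rightarrow> 'b set \<Rightarrow> ('b \<Rightarrow> 'b \<Rightarrow> real) \<Rightarrow> bool" where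
  "quasi_isometric M d N e \<longleftrightarrow>
     (\<exists>f A B C. f \<in> M \<rightarrow> N \<and> A \<ge> 1 \<and> B \<ge> 0 \<and> C \<ge> 0 \<and>
        (\<forall>x \<in> M. \<forall>y \<in> M. d x y / A - B \<le> e (f x) (f y) \<and> e (f x) (f y) \<le> A * d x y + B) \<and>
        (\<forall>z \<in> N. \<exists>x \<in> M. e (f x) z \<le> C))"

end

theory Submission
  imports Defs
begin

text \<open>The point symmetries of \<open>GAlex G \<sigma>\<close> are \<open>\<sigma>\<close>-equivariant for left translations,
  \<open>s\<^sub>y (a z) = \<sigma> a s\<^sub>y z\<close>, so that the generators \<open>s\<^sub>x s\<^sub>y\<inverse>\<close> of the displacement group, and hence all
  its elements, commute with left translations (\<open>Dis_GAlex_equivariant\<close>). As left translations are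
  transitive on the carrier, the displacement group acts freely.

  If the displacement group of a quandle acts freely, then for a base point \<open>p\<close> the orbit map
  \<open>g \<mapsto> g p\<close> identifies the Cayley graph of the displacement group with the graph on the orbit of \<open>p\<close>,
  for the same generating set \<open>U\<close>; it is an isometry from the word metric to the displacement metric
  (\<open>dis_metric_eq_word_metric\<close>). The orbit of \<open>p\<close> under the displacement group is the whole connected
  component, because a point symmetry moves \<open>p\<close> in the same way as a suitable displacement
  (\<open>orbit_Inn_eq_orbit_Dis\<close>). What remains, passing from the generating set \<open>U\<close> to \<open>S\<close>, is the
  bi-Lipschitz equivalence of word metrics for finite generating sets
  (\<open>word_metric_le_mult_word_metric\<close>).\<close>

section \<open>Comparison of word metrics\<close>

context group
begin

lemma sym_gens_closed: "S \<subseteq> carrier G \<Longrightarrow> sym_gens G S \<subseteq> carrier G"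
  by (auto simp: sym_gens_def)

lemma foldr_mult_closed: "set ws \<subseteq> carrier G \<Longrightarrow> foldr (\<otimes>) ws \<one> \<in> carrier G"
  by (induction ws) auto

lemma foldr_mult_append:
  "\<lbrakk>set vs \<subseteq> carrier G; set ws \<subseteq> carrier G\<rbrakk> \<Longrightarrow>
    foldr (\<otimes>) (vs @ ws) \<one> = foldr (\<otimes>) vs \<one> \<otimes> foldr (\<otimes>) ws \<one>"
  by (induction vs) (auto simp: foldr_mult_closed m_assoc simp del: foldr_append)

lemma generate_imp_word:
  assumes "S \<subseteq> carrier G" and "g \<in> generate G S"
  shows "\<exists>ws. set ws \<subseteq> sym_gens G S \<and> foldr (\<otimes>) ws \<one> = g"
  using assms(2)
proof induction
  case one
  show ?case by (rule exI[of _ "[]"]) simp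
next
  case (incl h)
  then show ?case using assms(1) by (intro exI[of _ "[h]"]) (auto simp: sym_gens_def)
next
  case (inv h)
  then show ?case using assms(1) by (intro exI[of _ "[inv h]"]) (auto simp: sym_gens_def)
next
  case (eng h1 h2)
  then obtain vs ws where "set vs \<subseteq> sym_gens G S" "foldr (\<otimes>) vs \<one> = h1"
      "set ws \<subseteq> sym_gens G S" "foldr (\<otimes>) ws \<one> = h2"
    by blast
  then show ?case
    using foldr_mult_append[of vs ws] sym_gens_closed[OF assms(1)] by (intro exI[of _ "vs @ ws"]) auto
qed

lemma word_length_le:
  "set ws \<subseteq> sym_gens G S \<Longrightarrow> word_length G S (foldr (\<otimes>) ws \<one>) \<le> length ws"
  unfolding word_length_def by (rule Least_le) blast

lemma word_length_attained:
  assumes "generates G S" and "g \<in> carrier G"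
  obtains ws where "length ws = word_length G S g" "set ws \<subseteq> sym_gens G S" "foldr (\<otimes>) ws \<one> = g"
proof -
  have "\<exists>n ws. length ws = n \<and> set ws \<subseteq> sym_gens G S \<and> foldr (\<otimes>) ws \<one> = g"
    using assms generate_imp_word[of S g] by (auto simp: generates_def)
  from LeastI_ex[OF this] show thesis
    using that unfolding word_length_def by blast
qed

lemma word_length_mult_le:
  assumes "generates G S" and "g \<in> carrier G" and "h \<in> carrier G"
  shows "word_length G S (g \<otimes> h) \<le> word_length G S g + word_length G S h"
proof -
  obtain vs ws where "length vs = word_length G S g" "set vs \<subseteq> sym_gens G S" "foldr (\<otimes>) vs \<one> = g"
      "length ws = word_length G S h" "set ws \<subseteq> sym_gens G S" "foldr (\<otimes>) ws \<one> = h"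
    using assms by (metis word_length_attained)
  then show ?thesis
    using word_length_le[of "vs @ ws" S] foldr_mult_append[of vs ws] sym_gens_closed[of S] assms(1)
    by (auto simp: generates_def)
qed

lemma word_length_foldr_le:
  assumes "generates G S" and "U \<subseteq> carrier G"
    and "\<And>u. u \<in> sym_gens G U \<Longrightarrow> word_length G S u \<le> K"
    and "set ws \<subseteq> sym_gens G U"
  shows "word_length G S (foldr (\<otimes>) ws \<one>) \<le> K * length ws"
  using assms(4)
proof (induction ws)
  case Nil
  show ?case using word_length_le[of "[]" S] by simp
next
  case (Cons u ws)
  have mem: "u \<in> carrier G" "foldr (\<otimes>) ws \<one> \<in> carrier G"
    using Cons.prems sym_gens_closed[OF assms(2)] by (auto intro: foldr_mult_closed)
  have "word_length G S (u \<otimes> foldr (\<otimes>) ws \<one>) \<le> word_length G S u + word_length G S (foldr (\<otimes>) ws \<one>)"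
    by (rule word_length_mult_le[OF assms(1) mem])
  also have "\<dots> \<le> K + K * length ws"
    using Cons assms(3) by (intro add_mono) auto
  finally show ?case by simp
qed

text \<open>Rewriting a \<open>U\<close>-word letter by letter in terms of \<open>S\<close> stretches it at most by the largest
  \<open>S\<close>-length of a letter, which exists since \<open>U\<close> is finite.\<close>

lemma word_metric_le_mult_word_metric:
  assumes "finite U" and "generates G U" and "generates G S"
  obtains K where "K \<ge> 1"
    "\<And>g h. \<lbrakk>g \<in> carrier G; h \<in> carrier G\<rbrakk> \<Longrightarrow> word_metric G S g h \<le> K * word_metric G U g h"
proof -
  \<comment> \<open>A sum is at least as large as the maximum of its terms; the successor makes \<open>K \<ge> 1\<close>.\<close>
  define K where "K = Suc (\<Sum>u \<in> sym_gens G U. word_length G S u)"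
  have "finite (sym_gens G U)"
    using assms(1) by (simp add: sym_gens_def)
  then have bound: "word_length G S u \<le> K" if "u \<in> sym_gens G U" for u
    using that member_le_sum[of u _ "word_length G S"] by (simp add: K_def le_Suc_eq)
  show thesis
  proof
    show "real K \<ge> 1"
      unfolding K_def by linarith
  next
    fix g h assume "g \<in> carrier G" "h \<in> carrier G"
    then obtain ws where "length ws = word_length G U (inv g \<otimes> h)" "set ws \<subseteq> sym_gens G U"
        "foldr (\<otimes>) ws \<one> = inv g \<otimes> h"
      using word_length_attained[OF assms(2), of "inv g \<otimes> h"] by auto
    then have "word_length G S (inv g \<otimes> h) \<le> K * word_length G U (inv g \<otimes> h)"
      using word_length_foldr_le[OF assms(3) _ bound] assms(2) by (metis generates_def)
    then show "word_metric G S g h \<le> real K * word_metric G U g h"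
      unfolding word_metric_def by (metis of_nat_le_iff of_nat_mult)
  qed
qed

lemma word_metric_self: "g \<in> carrier G \<Longrightarrow> word_metric G S g g = 0"
  using word_length_le[of "[]" S] by (simp add: word_metric_def)

text \<open>An isometry onto the group with one word metric is a quasi-isometry for any other, with additive
  constants \<open>0\<close>.\<close>

lemma quasi_isometric_word_metric:
  assumes "finite U" "generates G U" "finite S" "generates G S"
    and bij: "bij_betw f M (carrier G)"
    and isom: "\<And>x y. \<lbrakk>x \<in> M; y \<in> M\<rbrakk> \<Longrightarrow> d x y = word_metric G U (f x) (f y)"
  shows "quasi_isometric M d (carrier G) (word_metric G S)"
proof -
  obtain K where K: "K \<ge> 1"
    "\<And>g h. \<lbrakk>g \<in> carrier G; h \<in> carrier G\<rbrakk> \<Longrightarrow> word_metric G S g h \<le> K * word_metric G U g h"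
    using word_metric_le_mult_word_metric assms(1,2,4) by metis
  obtain L where L: "L \<ge> 1"
    "\<And>g h. \<lbrakk>g \<in> carrier G; h \<in> carrier G\<rbrakk> \<Longrightarrow> word_metric G U g h \<le> L * word_metric G S g h"
    using word_metric_le_mult_word_metric assms(3,4,2) by metis
  have nonneg: "word_metric G T g h \<ge> 0" for T g h
    by (simp add: word_metric_def)
  have bounds: "d x y / max K L - 0 \<le> word_metric G S (f x) (f y) \<and>
      word_metric G S (f x) (f y) \<le> max K L * d x y + 0" if "x \<in> M" "y \<in> M" for x y
  proof -
    have mem: "f x \<in> carrier G" "f y \<in> carrier G"
      using that bij by (auto simp: bij_betw_def)
    have "d x y \<le> max K L * word_metric G S (f x) (f y)"
      using L(2)[OF mem] mult_right_mono[OF max.cobounded2[of L K] nonneg[of S "f x" "f y"]]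
      by (simp add: isom that)
    moreover have "word_metric G S (f x) (f y) \<le> max K L * d x y"
      using K(2)[OF mem] mult_right_mono[OF max.cobounded1[of K L] nonneg[of U "f x" "f y"]]
      by (simp add: isom that)
    ultimately show ?thesis
      using K(1) by (simp add: pos_divide_le_eq mult.commute)
  qed
  have surj: "\<exists>x \<in> M. word_metric G S (f x) z \<le> 0" if z: "z \<in> carrier G" for z
  proof -
    have "z \<in> f ` M"
      using z bij by (simp add: bij_betw_def)
    then obtain x where "z = f x" "x \<in> M"
      by (rule imageE)
    then show ?thesis
      using word_metric_self[OF z] by (intro bexI[of _ x]) simp_all
  qed
  show ?thesis
    unfolding quasi_isometric_def
  proof (rule exI[of _ f], rule exI[of _ "max K L"], rule exI[of _ 0], rule exI[of _ 0],
      intro conjI ballI)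
    show "f \<in> M \<rightarrow> carrier G"
      using bij by (auto simp: bij_betw_def)
    show "1 \<le> max K L"
      using K(1) by simp
  qed (simp_all only: bounds surj order_refl)
qed

end

section \<open>The displacement group acting on a quandle\<close>

lemma mult_Aut_apply: "x \<in> carrier X \<Longrightarrow> (f \<otimes>\<^bsub>Aut X\<^esub> g) x = g (f x)"
  by (simp add: Aut_def compose_eq)

lemma one_Aut_apply: "x \<in> carrier X \<Longrightarrow> \<one>\<^bsub>Aut X\<^esub> x = x"
  by (simp add: Aut_def)

lemma mult_Dis [simp]: "mult (Dis X) = mult (Aut X)"
  and one_Dis [simp]: "one (Dis X) = one (Aut X)"
  by (simp_all add: Dis_def)

lemma Aut_apply_closed: "\<lbrakk>f \<in> carrier (Aut X); x \<in> carrier X\<rbrakk> \<Longrightarrow> f x \<in> carrier X"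
  by (auto simp: Aut_def dest: Bij_imp_funcset)

lemma Aut_eqI:
  assumes "f \<in> carrier (Aut X)" "g \<in> carrier (Aut X)" "\<And>x. x \<in> carrier X \<Longrightarrow> f x = g x"
  shows "f = g"
  using assms by (auto simp: Aut_def intro: extensionalityI dest: Bij_imp_extensional)

context quandle
begin

lemma inv_Aut_apply_left:
  assumes "f \<in> carrier (Aut X)" "x \<in> carrier X"
  shows "(inv\<^bsub>Aut X\<^esub> f) (f x) = x"
  using group.r_inv[OF group_Aut assms(1)] assms(2)
  by (metis mult_Aut_apply one_Aut_apply)

lemma inv_Aut_apply_right:
  assumes "f \<in> carrier (Aut X)" "x \<in> carrier X"
  shows "f ((inv\<^bsub>Aut X\<^esub> f) x) = x"
  using group.l_inv[OF group_Aut assms(1)] assms(2)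
  by (metis mult_Aut_apply one_Aut_apply)

lemma point_sym_apply: "x \<in> carrier X \<Longrightarrow> point_sym X y x = x \<triangleleft> y"
  by (simp add: point_sym_def)

lemma displacement_in_Aut:
  "\<lbrakk>x \<in> carrier X; y \<in> carrier X\<rbrakk> \<Longrightarrow>
    point_sym X x \<otimes>\<^bsub>Aut X\<^esub> inv\<^bsub>Aut X\<^esub> point_sym X y \<in> carrier (Aut X)"
  by (intro monoid.m_closed[OF group.is_monoid] group.inv_closed group_Aut point_sym_in_Aut)

lemma displacement_in_Dis:
  "\<lbrakk>x \<in> carrier X; y \<in> carrier X\<rbrakk> \<Longrightarrow>
    point_sym X x \<otimes>\<^bsub>Aut X\<^esub> inv\<^bsub>Aut X\<^esub> point_sym X y \<in> carrier (Dis X)"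
  by (auto simp: Dis_def intro!: generate.incl)

lemma subgroup_Dis: "subgroup (carrier (Dis X)) (Aut X)"
  using displacement_in_Aut by (auto simp: Dis_def intro!: group.generate_is_subgroup[OF group_Aut])

lemma subgroup_Inn: "subgroup (carrier (Inn X)) (Aut X)"
  using point_sym_in_Aut by (auto simp: Inn_def intro!: group.generate_is_subgroup[OF group_Aut])

lemma group_Dis: "group (Dis X)"
  using subgroup.subgroup_is_group[OF subgroup_Dis group_Aut] by (simp add: Dis_def)

lemma Dis_in_Aut: "f \<in> carrier (Dis X) \<Longrightarrow> f \<in> carrier (Aut X)"
  using subgroup.subset[OF subgroup_Dis] by blast

lemma Dis_subset_Inn: "carrier (Dis X) \<subseteq> carrier (Inn X)"
proof -
  have "point_sym X x \<otimes>\<^bsub>Aut X\<^esub> inv\<^bsub>Aut X\<^esub> point_sym X y \<in> carrier (Inn X)"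
    if "x \<in> carrier X" "y \<in> carrier X" for x y
  proof -
    have "point_sym X z \<in> carrier (Inn X)" if "z \<in> carrier X" for z
      using that by (auto simp: Inn_def intro: generate.incl)
    then show ?thesis
      using that subgroup_Inn by (simp add: subgroup.m_closed subgroup.m_inv_closed)
  qed
  then have "{point_sym X x \<otimes>\<^bsub>Aut X\<^esub> inv\<^bsub>Aut X\<^esub> point_sym X y | x y.
      x \<in> carrier X \<and> y \<in> carrier X} \<subseteq> carrier (Inn X)"
    by auto
  from group.generate_subgroup_incl[OF group_Aut this subgroup_Inn] show ?thesis
    by (simp add: Dis_def)
qed

text \<open>Since \<open>s\<^sub>p\<close> fixes \<open>p\<close>, the displacement \<open>s\<^sub>p s\<^sub>y\<inverse>\<close> moves \<open>p\<close> as \<open>s\<^sub>y\<inverse>\<close> does. For \<open>s\<^sub>y\<close> itself the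
  product \<open>s\<^sub>p\<inverse> s\<^sub>y\<close> would do; conjugating \<open>s\<^sub>y\<close> with \<open>s\<^sub>p\<close> brings it to the form \<open>s\<^sub>z s\<^sub>p\<inverse>\<close> of a generator,
  with \<open>z = y \<triangleleft> p\<close>.\<close>

lemma point_sym_eq_displacement:
  assumes "p \<in> carrier X" "y \<in> carrier X"
  shows "\<exists>g \<in> carrier (Dis X). g p = point_sym X y p"
    and "\<exists>g \<in> carrier (Dis X). g p = (inv\<^bsub>Aut X\<^esub> point_sym X y) p"
proof -
  have "point_sym X p (p \<triangleleft> y) = p \<triangleleft> (y \<triangleleft> p)"
    using distrib[OF assms(1,2,1)] idem[OF assms(1)] by (simp add: point_sym_apply closed assms)
  then have "(inv\<^bsub>Aut X\<^esub> point_sym X p) (p \<triangleleft> (y \<triangleleft> p)) = p \<triangleleft> y"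
    using inv_Aut_apply_left[OF point_sym_in_Aut[OF assms(1)] closed[OF assms]] by simp
  then have "(point_sym X (y \<triangleleft> p) \<otimes>\<^bsub>Aut X\<^esub> inv\<^bsub>Aut X\<^esub> point_sym X p) p = point_sym X y p"
    by (simp add: mult_Aut_apply point_sym_apply assms)
  then show "\<exists>g \<in> carrier (Dis X). g p = point_sym X y p"
    using displacement_in_Dis[OF closed[OF assms(2,1)] assms(1)] by blast
  have "(point_sym X p \<otimes>\<^bsub>Aut X\<^esub> inv\<^bsub>Aut X\<^esub> point_sym X y) p = (inv\<^bsub>Aut X\<^esub> point_sym X y) p"
    using idem[OF assms(1)] by (simp add: mult_Aut_apply point_sym_apply assms)
  then show "\<exists>g \<in> carrier (Dis X). g p = (inv\<^bsub>Aut X\<^esub> point_sym X y) p"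
    using displacement_in_Dis[OF assms] by blast
qed

lemma Inn_apply_eq_Dis_apply:
  assumes "f \<in> carrier (Inn X)" and "p \<in> carrier X"
  shows "\<exists>g \<in> carrier (Dis X). g p = f p"
proof -
  have "f \<in> generate (Aut X) {point_sym X y | y. y \<in> carrier X}"
    using assms(1) by (simp add: Inn_def)
  then show ?thesis
    using assms(2)
  proof (induction arbitrary: p)
    case one
    then show ?case
      using subgroup.one_closed[OF subgroup_Dis] by blast
  next
    case (incl h)
    then show ?case
      using point_sym_eq_displacement(1) by blast
  next
    case (inv h)
    then show ?case
      using point_sym_eq_displacement(2) by blast
  next
    case (eng h1 h2)
    obtain g1 where g1: "g1 \<in> carrier (Dis X)" "g1 p = h1 p"
      using eng.IH(1)[OF eng.prems] by blast
    moreover have "g1 p \<in> carrier X"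
      using g1(1) eng.prems by (simp add: Dis_in_Aut Aut_apply_closed)
    then obtain g2 where g2: "g2 \<in> carrier (Dis X)" "g2 (h1 p) = h2 (h1 p)"
      using eng.IH(2)[of "h1 p"] g1 by auto
    ultimately have "(g1 \<otimes>\<^bsub>Aut X\<^esub> g2) p = (h1 \<otimes>\<^bsub>Aut X\<^esub> h2) p"
      by (simp add: mult_Aut_apply eng.prems)
    then show ?case
      using subgroup.m_closed[OF subgroup_Dis g1(1) g2(1)] by blast
  qed
qed

lemma orbit_Inn_eq_orbit_Dis:
  assumes "p \<in> carrier X"
  shows "orbit (Inn X) (\<lambda>f x. f x) p = (\<lambda>g. g p) ` carrier (Dis X)"
proof
  show "orbit (Inn X) (\<lambda>f x. f x) p \<subseteq> (\<lambda>g. g p) ` carrier (Dis X)"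
  proof
    fix x assume "x \<in> orbit (Inn X) (\<lambda>f x. f x) p"
    then obtain f where "f \<in> carrier (Inn X)" "x = f p"
      by (auto simp: orbit_def)
    then show "x \<in> (\<lambda>g. g p) ` carrier (Dis X)"
      using Inn_apply_eq_Dis_apply[of f p] assms by (metis image_eqI)
  qed
  show "(\<lambda>g. g p) ` carrier (Dis X) \<subseteq> orbit (Inn X) (\<lambda>f x. f x) p"
    using Dis_subset_Inn by (auto simp: orbit_def)
qed

text \<open>A path in the graph reads off a word whose letters are applied from left to right; this matches
  the order of the product in the group of automorphisms.\<close>

lemma relpow_dis_graph_iff:
  assumes "generates (Dis X) U" and "x \<in> carrier X"
  shows "(x, y) \<in> dis_graph X U ^^ n \<longleftrightarrow>
    (\<exists>ws. length ws = n \<and> set ws \<subseteq> sym_gens (Dis X) U \<and> y = foldr (mult (Dis X)) ws \<one>\<^bsub>Dis X\<^esub> x)"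
  using assms(2)
proof (induction n arbitrary: x)
  case 0
  then show ?case by (auto simp: one_Aut_apply)
next
  case (Suc n)
  have "sym_gens (Dis X) U \<subseteq> carrier (Dis X)"
    using assms(1) by (simp add: generates_def group.sym_gens_closed[OF group_Dis])
  then have mem: "u x \<in> carrier X" if "u \<in> sym_gens (Dis X) U" for u
    using that Suc.prems by (simp add: Aut_apply_closed Dis_in_Aut subset_iff)
  have "(x, y) \<in> dis_graph X U ^^ Suc n \<longleftrightarrow>
      (\<exists>u \<in> sym_gens (Dis X) U. (u x, y) \<in> dis_graph X U ^^ n)"
  proof
    assume "(x, y) \<in> dis_graph X U ^^ Suc n"
    then obtain z where "(x, z) \<in> dis_graph X U" "(z, y) \<in> dis_graph X U ^^ n"
      by (rule relpow_Suc_E2)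
    then show "\<exists>u \<in> sym_gens (Dis X) U. (u x, y) \<in> dis_graph X U ^^ n"
      by (auto simp: dis_graph_def)
  next
    assume "\<exists>u \<in> sym_gens (Dis X) U. (u x, y) \<in> dis_graph X U ^^ n"
    then obtain u where u: "u \<in> sym_gens (Dis X) U" "(u x, y) \<in> dis_graph X U ^^ n"
      by blast
    then have "(x, u x) \<in> dis_graph X U"
      using mem Suc.prems by (auto simp: dis_graph_def)
    then show "(x, y) \<in> dis_graph X U ^^ Suc n"
      using u(2) by (rule relpow_Suc_I2)
  qed
  also have "\<dots> \<longleftrightarrow> (\<exists>u \<in> sym_gens (Dis X) U. \<exists>ws. length ws = n \<and> set ws \<subseteq> sym_gens (Dis X) U \<and>
      y = foldr (mult (Dis X)) (u # ws) \<one>\<^bsub>Dis X\<^esub> x)"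
    using Suc.IH mem Suc.prems by (simp add: mult_Aut_apply)
  also have "\<dots> \<longleftrightarrow> (\<exists>ws. length ws = Suc n \<and> set ws \<subseteq> sym_gens (Dis X) U \<and>
      y = foldr (mult (Dis X)) ws \<one>\<^bsub>Dis X\<^esub> x)"
  proof -
    have "(\<exists>ws. length ws = Suc n \<and> Q ws) \<longleftrightarrow> (\<exists>u ws. length ws = n \<and> Q (u # ws))"
      for Q :: "('a \<Rightarrow> 'a) list \<Rightarrow> bool"
      by (auto simp: length_Suc_conv)
    then show ?thesis
      by (simp only: list.set insert_subset) blast
  qed
  finally show ?case .
qed

text \<open>Paths from \<open>g p\<close> to \<open>h p\<close> correspond to words \<open>w\<close> with \<open>(g w) p = h p\<close>; freeness at \<open>p\<close> turns this
  into \<open>w = g\<inverse> h\<close>, so both distances are minima over the same words.\<close>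

lemma dis_metric_eq_word_metric:
  assumes U: "generates (Dis X) U" and p: "p \<in> carrier X"
    and free: "inj_on (\<lambda>g. g p) (carrier (Dis X))"
    and g: "g \<in> carrier (Dis X)" and h: "h \<in> carrier (Dis X)"
  shows "dis_metric X U (g p) (h p) = word_metric (Dis X) U g h"
proof -
  interpret D: group "Dis X" by (rule group_Dis)
  have gp: "g p \<in> carrier X"
    using g p by (simp add: Dis_in_Aut Aut_apply_closed)
  have word_iff: "h p = w (g p) \<longleftrightarrow> w = inv\<^bsub>Dis X\<^esub> g \<otimes>\<^bsub>Dis X\<^esub> h" if w: "w \<in> carrier (Dis X)" for w
  proof -
    have "h p = w (g p) \<longleftrightarrow> h p = (g \<otimes>\<^bsub>Dis X\<^esub> w) p"
      using p by (simp add: mult_Aut_apply)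
    also have "\<dots> \<longleftrightarrow> h = g \<otimes>\<^bsub>Dis X\<^esub> w"
      using inj_on_eq_iff[OF free h D.m_closed[OF g w]] .
    also have "\<dots> \<longleftrightarrow> w = inv\<^bsub>Dis X\<^esub> g \<otimes>\<^bsub>Dis X\<^esub> h"
      using D.inv_solve_left[OF w g h] by auto
    finally show ?thesis .
  qed
  have closed: "foldr (mult (Dis X)) ws \<one>\<^bsub>Dis X\<^esub> \<in> carrier (Dis X)"
    if "set ws \<subseteq> sym_gens (Dis X) U" for ws
    using that U D.sym_gens_closed[of U] D.foldr_mult_closed[of ws] by (auto simp: generates_def)
  have "(g p, h p) \<in> dis_graph X U ^^ n \<longleftrightarrow>
      (\<exists>ws. length ws = n \<and> set ws \<subseteq> sym_gens (Dis X) U \<and>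
        foldr (mult (Dis X)) ws \<one>\<^bsub>Dis X\<^esub> = inv\<^bsub>Dis X\<^esub> g \<otimes>\<^bsub>Dis X\<^esub> h)" for n
    unfolding relpow_dis_graph_iff[OF U gp] using word_iff closed by blast
  then show ?thesis
    by (simp only: dis_metric_def path_metric_def word_metric_def word_length_def)
qed

text \<open>The inverse of the orbit map at a base point \<open>p\<close> is the required map from the component to the
  displacement group.\<close>

lemma quasi_isometric_component_Dis:
  assumes free: "\<And>p. p \<in> carrier X \<Longrightarrow> inj_on (\<lambda>g. g p) (carrier (Dis X))"
    and C: "C \<in> connected_components X"
    and gens: "finite U" "generates (Dis X) U" "finite S" "generates (Dis X) S"
  shows "quasi_isometric C (dis_metric X U) (carrier (Dis X)) (word_metric (Dis X) S)"
proof -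
  obtain p where p: "p \<in> carrier X" and C_eq: "C = (\<lambda>g. g p) ` carrier (Dis X)"
    using C orbit_Inn_eq_orbit_Dis by (auto simp: connected_components_def orbits_def)
  have bij: "bij_betw (\<lambda>g. g p) (carrier (Dis X)) C"
    using free[OF p] C_eq by (simp add: bij_betw_def)
  let ?f = "inv_into (carrier (Dis X)) (\<lambda>g. g p)"
  show ?thesis
  proof (rule group.quasi_isometric_word_metric[OF group_Dis gens])
    show "bij_betw ?f C (carrier (Dis X))"
      using bij by (rule bij_betw_inv_into)
  next
    fix x y assume "x \<in> C" "y \<in> C"
    then obtain g h where "g \<in> carrier (Dis X)" "x = g p" "h \<in> carrier (Dis X)" "y = h p"
      using C_eq by blast
    then show "dis_metric X U x y = word_metric (Dis X) U (?f x) (?f y)"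
      using dis_metric_eq_word_metric[OF gens(2) p free[OF p]] inv_into_f_f[OF free[OF p]] by simp
  qed
qed

end

section \<open>Displacements of generalized Alexander quandles\<close>

lemma carrier_GAlex [simp]: "carrier (GAlex G \<sigma>) = carrier G"
  by (simp add: GAlex_def)

lemma point_sym_GAlex_mult:
  assumes "group G" and "\<sigma> \<in> iso G G" and "a \<in> carrier G" "z \<in> carrier G" "y \<in> carrier G"
  shows "point_sym (GAlex G \<sigma>) y (a \<otimes>\<^bsub>G\<^esub> z) = \<sigma> a \<otimes>\<^bsub>G\<^esub> point_sym (GAlex G \<sigma>) y z"
proof -
  interpret group G by fact
  interpret hom: group_hom G G \<sigma>
    using assms(1,2) by (simp add: group_hom_def group_hom_axioms_def iso_def)
  have "\<sigma> (a \<otimes>\<^bsub>G\<^esub> z \<otimes>\<^bsub>G\<^esub> inv\<^bsub>G\<^esub> y) = \<sigma> a \<otimes>\<^bsub>G\<^esub> \<sigma> (z \<otimes>\<^bsub>G\<^esub> inv\<^bsub>G\<^esub> y)"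
    using assms(3-) by (simp add: m_assoc del: hom.hom_inv)
  then show ?thesis
    using assms(3-) by (simp add: point_sym_def GAlex_def m_assoc del: hom.hom_mult)
qed

text \<open>The twist by \<open>\<sigma>\<close> that \<open>s\<^sub>x\<close> introduces is undone by \<open>s\<^sub>y\<inverse>\<close>, so the generators commute with left
  translations, and the maps that do so form a subgroup.\<close>

lemma Dis_GAlex_equivariant:
  assumes G: "group G" and \<sigma>: "\<sigma> \<in> iso G G"
    and f: "f \<in> carrier (Dis (GAlex G \<sigma>))" and a: "a \<in> carrier G" and z: "z \<in> carrier G"
  shows "f (a \<otimes>\<^bsub>G\<^esub> z) = a \<otimes>\<^bsub>G\<^esub> f z"
proof -
  let ?X = "GAlex G \<sigma>"
  interpret group G by fact
  interpret quandle ?X by (rule quandle_GAlex[OF G \<sigma>])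
  note apply_closed = Aut_apply_closed[of _ ?X, simplified]
  note group.inv_closed[OF group_Aut, simp]
  \<comment> \<open>The rule for inverses: \<open>f\<close> semicommutes with left translations along \<open>\<alpha>\<close>, so \<open>f\<inverse>\<close> does along \<open>\<alpha>\<inverse>\<close>.
    It serves both for \<open>\<alpha> = \<sigma>\<close> and for \<open>\<alpha> = id\<close>.\<close>
  have inv_equivariant: "(inv\<^bsub>Aut ?X\<^esub> f) (\<alpha> b \<otimes>\<^bsub>G\<^esub> w) = b \<otimes>\<^bsub>G\<^esub> (inv\<^bsub>Aut ?X\<^esub> f) w"
    if f: "f \<in> carrier (Aut ?X)" and b: "b \<in> carrier G" and w: "w \<in> carrier G"
      and eq: "\<And>v. v \<in> carrier G \<Longrightarrow> f (b \<otimes>\<^bsub>G\<^esub> v) = \<alpha> b \<otimes>\<^bsub>G\<^esub> f v" for f b w \<alpha>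
  proof -
    let ?v = "(inv\<^bsub>Aut ?X\<^esub> f) w"
    have v: "?v \<in> carrier G"
      using f w by (simp add: apply_closed)
    then have "f (b \<otimes>\<^bsub>G\<^esub> ?v) = \<alpha> b \<otimes>\<^bsub>G\<^esub> w"
      using f w eq inv_Aut_apply_right[of f w] by simp
    then show ?thesis
      using inv_Aut_apply_left[OF f, of "b \<otimes>\<^bsub>G\<^esub> ?v"] b v by simp
  qed
  let ?gens = "{point_sym ?X x \<otimes>\<^bsub>Aut ?X\<^esub> inv\<^bsub>Aut ?X\<^esub> point_sym ?X y | x y.
    x \<in> carrier ?X \<and> y \<in> carrier ?X}"
  have gen: "h \<in> carrier (Aut ?X)" "h (b \<otimes>\<^bsub>G\<^esub> w) = b \<otimes>\<^bsub>G\<^esub> h w"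
    if h: "h \<in> ?gens" and b: "b \<in> carrier G" and w: "w \<in> carrier G" for h b w
  proof -
    obtain x y where h_eq: "h = point_sym ?X x \<otimes>\<^bsub>Aut ?X\<^esub> inv\<^bsub>Aut ?X\<^esub> point_sym ?X y"
      and xy: "x \<in> carrier G" "y \<in> carrier G"
      using h by auto
    show "h \<in> carrier (Aut ?X)"
      using displacement_in_Aut xy by (simp add: h_eq)
    have "point_sym ?X x w \<in> carrier G"
      using xy w point_sym_in_Aut by (simp add: apply_closed)
    then show "h (b \<otimes>\<^bsub>G\<^esub> w) = b \<otimes>\<^bsub>G\<^esub> h w"
      using inv_equivariant[of "point_sym ?X y" b _ \<sigma>] xy b w point_sym_in_Aut
      by (simp add: h_eq mult_Aut_apply point_sym_GAlex_mult[OF G \<sigma>])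
  qed
  have "f \<in> generate (Aut ?X) ?gens"
    using f by (simp add: Dis_def)
  then show ?thesis
    using a z
  proof (induction arbitrary: a z)
    case one
    then show ?case by (simp add: one_Aut_apply)
  next
    case (incl h)
    show ?case by (rule gen(2)[OF incl.hyps incl.prems])
  next
    case (inv h)
    show ?case
      by (rule inv_equivariant[where \<alpha> = "\<lambda>b. b",
            OF gen(1)[OF inv.hyps inv.prems] inv.prems gen(2)[OF inv.hyps inv.prems(1)]])
  next
    case (eng h1 h2)
    have "h1 \<in> carrier (Dis ?X)"
      using eng.hyps(1) by (simp add: Dis_def)
    then have "h1 z \<in> carrier G"
      using eng.prems(2) by (simp add: apply_closed Dis_in_Aut)
    then show ?case
      using eng.IH eng.prems by (simp add: mult_Aut_apply)
  qed
qed

text \<open>A displacement is determined by its value at one point \<open>p\<close>, because every point is a left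
  translate of \<open>p\<close>.\<close>

lemma Dis_GAlex_free:
  assumes G: "group G" and \<sigma>: "\<sigma> \<in> iso G G" and p: "p \<in> carrier G"
  shows "inj_on (\<lambda>g. g p) (carrier (Dis (GAlex G \<sigma>)))"
proof (rule inj_onI)
  interpret group G by fact
  interpret quandle "GAlex G \<sigma>" by (rule quandle_GAlex[OF G \<sigma>])
  fix g h assume g: "g \<in> carrier (Dis (GAlex G \<sigma>))" and h: "h \<in> carrier (Dis (GAlex G \<sigma>))"
    and eq: "g p = h p"
  show "g = h"
  proof (rule Aut_eqI[OF Dis_in_Aut[OF g] Dis_in_Aut[OF h]])
    fix x assume "x \<in> carrier (GAlex G \<sigma>)"
    then have x: "x \<otimes>\<^bsub>G\<^esub> inv\<^bsub>G\<^esub> p \<in> carrier G" "x = (x \<otimes>\<^bsub>G\<^esub> inv\<^bsub>G\<^esub> p) \<otimes>\<^bsub>G\<^esub> p"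
      using p by (simp_all add: m_assoc)
    show "g x = h x"
      using Dis_GAlex_equivariant[OF G \<sigma> g x(1) p] Dis_GAlex_equivariant[OF G \<sigma> h x(1) p] eq x(2)
      by metis
  qed
qed

theorem theorem1p5:
  fixes G :: "('a, 'm) monoid_scheme" and \<sigma> :: "'a \<Rightarrow> 'a"
  assumes "group G" and "\<sigma> \<in> iso G G"
    and "finitely_generated (Dis (GAlex G \<sigma>))"
  shows "\<forall>C \<in> connected_components (GAlex G \<sigma>). \<forall>U S.
    finite U \<and> generates (Dis (GAlex G \<sigma>)) U \<and> finite S \<and> generates (Dis (GAlex G \<sigma>)) S \<longrightarrow>
    quasi_isometric C (dis_metric (GAlex G \<sigma>) U)
      (carrier (Dis (GAlex G \<sigma>))) (word_metric (Dis (GAlex G \<sigma>)) S)"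
  using quandle.quasi_isometric_component_Dis[OF quandle_GAlex[OF assms(1,2)]]
    Dis_GAlex_free[OF assms(1,2)]
  by simp

end
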